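(* Let $(F,P)$ be an almost biparacomplex structure on a manifold $M$ and let $\nabla$ be its canonical connection, with torsion tensor field $T$. Then the following three conditions are equivalent: (i) $(F,P)$ is a biparacomplex structure; (ii) $[F,P]=0$; (iii) $T=0$, i.e. $\nabla$ is torsion-free.
   Context: Manifolds and tensor fields are $C^\infty$. An almost biparacomplex structure on $M$ is a pair $(F,P)$ of tensor fields of type $(1,1)$ with $F^2=P^2=\mathrm{Id}$ and $F\circ P+P\circ F=0$. Put $T_F^{\pm}(M)=\ker(F\mp\mathrm{Id})$ and $T_P^{\pm}(M)=\ker(P\mp\mathrm{Id})$. The structure $(F,P)$ is called biparacomplex if the four distributions $T_F^{+}(M),T_F^{-}(M),T_P^{+}(M),T_P^{-}(M)$ are involutive. The canonical connection of $(F,P)$ is the unique linear connection $\nabla$ on $M$ such that $\nabla F=0=\nabla P$ and $T(X,Y)=0$ for all $X\in T_F^+(M)$, $Y\in T_F^-(M)$, where $T(X,Y)=\nabla_XY-\nabla_YX-[X,Y]$. $[F,P]$ denotes the (Frölicher–)Nijenhuis bracket, the tensor field of type $(1,2)$ given for vector fields $X,Y$ by $$[F,P](X,Y)=[FX,PY]+[PX,FY]+PF[X,Y]+FP[X,Y]-F[PX,Y]-F[X,PY]-P[FX,Y]-P[X,FY],$$ where $PF[X,Y]+FP[X,Y]=0$ in the present situation. *)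

theory Defs
  imports "HOL-Analysis.Analysis" "HOL-Library.Function_Algebras"
begin

section \<open>Smooth manifolds\<close>

text \<open>
  \<open>Ck_on k S f\<close> is meant for open \<open>S\<close> in a finite-dimensional space. There, differentiability
  together with \<open>C\<^sup>k\<close> directional derivatives in all (constant) directions is the same as being of
  class \<open>C\<^bsup>k+1\<^esup>\<close>.
\<close>

primrec Ck_on :: "nat \<Rightarrow> 'a::real_normed_vector set \<Rightarrow> ('a \<Rightarrow> 'b::real_normed_vector) \<Rightarrow> bool" where
  "Ck_on 0 S f \<longleftrightarrow> continuous_on S f"
| "Ck_on (Suc k) S f \<longleftrightarrow>
     (\<forall>x\<in>S. f differentiable (at x)) \<and> (\<forall>v. Ck_on k S (\<lambda>x. frechet_derivative f (at x) v))"

definition smooth_on :: "'a::real_normed_vector set \<Rightarrow> ('a \<Rightarrow> 'b::real_normed_vector) \<Rightarrow> bool" where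
  "smooth_on S f \<longleftrightarrow> (\<forall>k. Ck_on k S f)"

text \<open>
  The underlying set of the manifold is the whole type \<open>'m\<close> (Hausdorff and second countable by its
  type classes), and the model space is \<open>'e\<close>. An atlas need not be maximal: it is used only through
  the smooth structure it generates.
\<close>

type_synonym ('m, 'e) chart = "'m set \<times> ('m \<Rightarrow> 'e)"

definition is_chart :: "('m::topological_space, 'e::euclidean_space) chart \<Rightarrow> bool" where
  "is_chart c \<longleftrightarrow> (case c of (U, \<phi>) \<Rightarrow>
     open U \<and> open (\<phi> ` U) \<and> homeomorphism U (\<phi> ` U) \<phi> (inv_into U \<phi>))"

definition smooth_atlas ::
  "('m::{t2_space, second_countable_topology}, 'e::euclidean_space) chart set \<Rightarrow> bool" where
  "smooth_atlas A \<longleftrightarrow>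
     (\<forall>c\<in>A. is_chart c) \<and>
     (\<Union>(U, \<phi>)\<in>A. U) = UNIV \<and>
     (\<forall>(U, \<phi>)\<in>A. \<forall>(V, \<psi>)\<in>A. smooth_on (\<phi> ` (U \<inter> V)) (\<psi> \<circ> inv_into U \<phi>))"

definition smooth_funs :: "('m, 'e::euclidean_space) chart set \<Rightarrow> ('m \<Rightarrow> real) set" where
  "smooth_funs A = {f. \<forall>(U, \<phi>)\<in>A. smooth_on (\<phi> ` U) (f \<circ> inv_into U \<phi>)}"


section \<open>Tangent vectors, vector fields and tensor fields\<close>

text \<open>
  Sums, differences, \<open>0\<close> and products of functions (hence of scalar functions, tangent vectors and
  vector fields) are the pointwise ones. Tangent vectors at \<open>p\<close> are the derivations at \<open>p\<close> of the
  algebra of smooth functions; they are set to \<open>0\<close> on non-smooth functions so that equality of HOL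
  functions is equality of derivations.
\<close>

type_synonym 'm tvec = "('m \<Rightarrow> real) \<Rightarrow> real"
type_synonym 'm vfield = "'m \<Rightarrow> 'm tvec"
type_synonym 'm endo_field = "'m \<Rightarrow> 'm tvec \<Rightarrow> 'm tvec"

definition tscale :: "real \<Rightarrow> 'm tvec \<Rightarrow> 'm tvec" where
  "tscale c v = (\<lambda>f. c * v f)"

definition tangent_space :: "('m, 'e::euclidean_space) chart set \<Rightarrow> 'm \<Rightarrow> 'm tvec set" where
  "tangent_space A p = {v.
     (\<forall>f\<in>smooth_funs A. \<forall>g\<in>smooth_funs A.
        v (f + g) = v f + v g \<and> v (f * g) = f p * v g + g p * v f) \<and>
     (\<forall>c. \<forall>f\<in>smooth_funs A. v (\<lambda>q. c * f q) = c * v f) \<and>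
     (\<forall>f. f \<notin> smooth_funs A \<longrightarrow> v f = 0)}"

definition vector_fields :: "('m, 'e::euclidean_space) chart set \<Rightarrow> 'm vfield set" where
  "vector_fields A = {X. (\<forall>p. X p \<in> tangent_space A p) \<and>
     (\<forall>f\<in>smooth_funs A. (\<lambda>p. X p f) \<in> smooth_funs A)}"

definition fmul :: "('m \<Rightarrow> real) \<Rightarrow> 'm vfield \<Rightarrow> 'm vfield" where
  "fmul f X = (\<lambda>p. tscale (f p) (X p))"

definition lie :: "'m vfield \<Rightarrow> 'm vfield \<Rightarrow> 'm vfield" where
  "lie X Y = (\<lambda>p f. X p (\<lambda>q. Y q f) - Y p (\<lambda>q. X q f))"

definition endo_app :: "'m endo_field \<Rightarrow> 'm vfield \<Rightarrow> 'm vfield" (infixr \<open>\<cdot>\<close> 80) where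
  "F \<cdot> X = (\<lambda>p. F p (X p))"

text \<open>Smooth tensor fields of type \<open>(1,1)\<close>; the values \<open>F p v\<close> for \<open>v\<close> not tangent at \<open>p\<close> are
  irrelevant junk.\<close>

definition tensor_fields_11 :: "('m, 'e::euclidean_space) chart set \<Rightarrow> 'm endo_field set" where
  "tensor_fields_11 A = {F.
     (\<forall>p. \<forall>v\<in>tangent_space A p. F p v \<in> tangent_space A p) \<and>
     (\<forall>p. \<forall>v\<in>tangent_space A p. \<forall>w\<in>tangent_space A p. F p (v + w) = F p v + F p w) \<and>
     (\<forall>p c. \<forall>v\<in>tangent_space A p. F p (tscale c v) = tscale c (F p v)) \<and>
     (\<forall>X\<in>vector_fields A. F \<cdot> X \<in> vector_fields A)}"


section \<open>Distributions\<close>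

type_synonym 'm distribution = "'m \<Rightarrow> 'm tvec set"

definition dist_plus ::
  "('m, 'e::euclidean_space) chart set \<Rightarrow> 'm endo_field \<Rightarrow> 'm distribution" where
  "dist_plus A F p = {v \<in> tangent_space A p. F p v - v = 0}"

definition dist_minus ::
  "('m, 'e::euclidean_space) chart set \<Rightarrow> 'm endo_field \<Rightarrow> 'm distribution" where
  "dist_minus A F p = {v \<in> tangent_space A p. F p v + v = 0}"

definition sections ::
  "('m, 'e::euclidean_space) chart set \<Rightarrow> 'm distribution \<Rightarrow> 'm vfield set" where
  "sections A D = {X \<in> vector_fields A. \<forall>p. X p \<in> D p}"

definition involutive ::
  "('m, 'e::euclidean_space) chart set \<Rightarrow> 'm distribution \<Rightarrow> bool" where
  "involutive A D \<longleftrightarrow> (\<forall>X\<in>sections A D. \<forall>Y\<in>sections A D. lie X Y \<in> sections A D)"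


section \<open>Biparacomplex structures\<close>

definition almost_biparacomplex ::
  "('m, 'e::euclidean_space) chart set \<Rightarrow> 'm endo_field \<Rightarrow> 'm endo_field \<Rightarrow> bool" where
  "almost_biparacomplex A F P \<longleftrightarrow>
     F \<in> tensor_fields_11 A \<and> P \<in> tensor_fields_11 A \<and>
     (\<forall>p. \<forall>v\<in>tangent_space A p.
        F p (F p v) = v \<and> P p (P p v) = v \<and> F p (P p v) + P p (F p v) = 0)"

definition biparacomplex ::
  "('m, 'e::euclidean_space) chart set \<Rightarrow> 'm endo_field \<Rightarrow> 'm endo_field \<Rightarrow> bool" where
  "biparacomplex A F P \<longleftrightarrow> almost_biparacomplex A F P \<and>
     involutive A (dist_plus A F) \<and> involutive A (dist_minus A F) \<and>
     involutive A (dist_plus A P) \<and> involutive A (dist_minus A P)"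

definition nijenhuis_bracket ::
  "'m endo_field \<Rightarrow> 'm endo_field \<Rightarrow> 'm vfield \<Rightarrow> 'm vfield \<Rightarrow> 'm vfield" where
  "nijenhuis_bracket F P X Y =
     lie (F \<cdot> X) (P \<cdot> Y) + lie (P \<cdot> X) (F \<cdot> Y) + P \<cdot> F \<cdot> lie X Y + F \<cdot> P \<cdot> lie X Y
     - F \<cdot> lie (P \<cdot> X) Y - F \<cdot> lie X (P \<cdot> Y) - P \<cdot> lie (F \<cdot> X) Y - P \<cdot> lie X (F \<cdot> Y)"


section \<open>Linear connections\<close>

text \<open>\<open>nabla X Y\<close> is the covariant derivative of \<open>Y\<close> along \<open>X\<close>; only its values on smooth vector
  fields matter. On those, the conditions in \<open>canonical_connection\<close> determine \<open>nabla\<close> uniquely.\<close>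

type_synonym 'm conn = "'m vfield \<Rightarrow> 'm vfield \<Rightarrow> 'm vfield"

definition linear_connection :: "('m, 'e::euclidean_space) chart set \<Rightarrow> 'm conn \<Rightarrow> bool" where
  "linear_connection A nabla \<longleftrightarrow>
     (\<forall>X\<in>vector_fields A. \<forall>Y\<in>vector_fields A. nabla X Y \<in> vector_fields A) \<and>
     (\<forall>X\<in>vector_fields A. \<forall>Y\<in>vector_fields A. \<forall>Z\<in>vector_fields A.
        nabla (X + Y) Z = nabla X Z + nabla Y Z \<and> nabla X (Y + Z) = nabla X Y + nabla X Z) \<and>
     (\<forall>f\<in>smooth_funs A. \<forall>X\<in>vector_fields A. \<forall>Y\<in>vector_fields A.
        nabla (fmul f X) Y = fmul f (nabla X Y) \<and>
        nabla X (fmul f Y) = fmul (\<lambda>p. X p f) Y + fmul f (nabla X Y))"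

definition parallel ::
  "('m, 'e::euclidean_space) chart set \<Rightarrow> 'm conn \<Rightarrow> 'm endo_field \<Rightarrow> bool" where
  "parallel A nabla F \<longleftrightarrow>
     (\<forall>X\<in>vector_fields A. \<forall>Y\<in>vector_fields A. nabla X (F \<cdot> Y) - F \<cdot> nabla X Y = 0)"

definition torsion :: "'m conn \<Rightarrow> 'm vfield \<Rightarrow> 'm vfield \<Rightarrow> 'm vfield" where
  "torsion nabla X Y = nabla X Y - nabla Y X - lie X Y"

definition canonical_connection ::
  "('m, 'e::euclidean_space) chart set \<Rightarrow> 'm endo_field \<Rightarrow> 'm endo_field \<Rightarrow> 'm conn \<Rightarrow> bool" where
  "canonical_connection A F P nabla \<longleftrightarrow>
     linear_connection A nabla \<and> parallel A nabla F \<and> parallel A nabla P \<and>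
     (\<forall>X\<in>sections A (dist_plus A F). \<forall>Y\<in>sections A (dist_minus A F). torsion nabla X Y = 0)"

end

theory Submission
  imports Defs
begin

text \<open>
  On sections \<open>X, Y\<close> of \<open>T\<^sub>F\<^sup>+\<close>, the bracket \<open>[F,P](X,Y)\<close> is \<open>Z - F Z - 2 P [X,Y]\<close> with
  \<open>Z = [X, P Y] + [P X, Y]\<close>, so its vanishing puts \<open>P [X,Y]\<close> into \<open>T\<^sub>F\<^sup>-\<close> and hence \<open>[X,Y]\<close> into
  \<open>T\<^sub>F\<^sup>+\<close>; the other three distributions are handled alike. A torsion-free connection expresses the
  bracket through \<open>\<nabla>\<close>, and \<open>\<nabla>\<close> commutes with \<open>F\<close> and \<open>P\<close>, so \<open>[F,P] = 0\<close>.
  If all four distributions are involutive and \<open>X, Y\<close> are sections of \<open>T\<^sub>F\<^sup>+\<close>, then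
  \<open>T(X \<plusminus> P X, Y \<plusminus> P Y) = T(X,Y) + T(P X, P Y)\<close> for both signs, so this field lies in
  \<open>T\<^sub>P\<^sup>+ \<inter> T\<^sub>P\<^sup>- = 0\<close>; its two summands lie in \<open>T\<^sub>F\<^sup>+\<close> and \<open>T\<^sub>F\<^sup>-\<close> and therefore vanish separately.
  Since \<open>P\<close> maps \<open>T\<^sub>F\<^sup>+\<close> onto \<open>T\<^sub>F\<^sup>-\<close>, this covers all pairs of sections.
\<close>

section \<open>The algebra of smooth functions\<close>

text \<open>On an open set the derivative at a point depends only on values in the set, so agreement
  passes on to the directional derivatives. The sum and product rules hold only at points of
  \<open>S\<close>; this carries them over to \<open>frechet_derivative\<close>.\<close>

lemma Ck_on_cong:
  assumes "open S" and "\<And>x. x \<in> S \<Longrightarrow> f x = g x"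
  shows "Ck_on k S f \<longleftrightarrow> Ck_on k S g"
  using assms(2)
proof (induction k arbitrary: f g)
  case 0
  then show ?case by (simp cong: continuous_on_cong)
next
  case (Suc k)
  have *: "(f has_derivative D) (at x) \<longleftrightarrow> (g has_derivative D) (at x)" if "x \<in> S" for x D
    using Suc.prems assms(1) that
    by (metis has_derivative_transform_within_open)
  have "f differentiable (at x) \<longleftrightarrow> g differentiable (at x)"
    and fd: "frechet_derivative f (at x) = frechet_derivative g (at x)" if "x \<in> S" for x
    using * that by (auto simp: differentiable_def frechet_derivative_def)
  moreover have "Ck_on k S (\<lambda>x. frechet_derivative f (at x) v) \<longleftrightarrow>
      Ck_on k S (\<lambda>x. frechet_derivative g (at x) v)" for v
    by (rule Suc.IH) (simp add: fd)
  ultimately show ?case by simp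
qed

text \<open>The product rule multiplies a derivative by an undifferentiated factor, whose class must
  be lowered by one to fit the induction.\<close>

lemma Ck_on_Suc_imp: "Ck_on (Suc k) S f \<Longrightarrow> Ck_on k S f"
proof (induction k arbitrary: f)
  case 0
  then show ?case
    by (auto intro!: continuous_at_imp_continuous_on differentiable_imp_continuous_within)
next
  case (Suc k)
  then show ?case by auto
qed

lemma Ck_on_const: "Ck_on k S (\<lambda>_. c)"
  by (induction k arbitrary: c) auto

lemma Ck_on_add:
  assumes "open S" "Ck_on k S f" "Ck_on k S g"
  shows "Ck_on k S (\<lambda>x. f x + g x)"
  using assms(2,3)
proof (induction k arbitrary: f g)
  case 0
  then show ?case by (simp add: continuous_on_add)
next
  case (Suc k)
  have *: "Ck_on k S (\<lambda>x. frechet_derivative f (at x) v + frechet_derivative g (at x) v)" for v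
    using Suc by simp
  have deriv: "frechet_derivative (\<lambda>x. f x + g x) (at x) v =
      frechet_derivative f (at x) v + frechet_derivative g (at x) v" if "x \<in> S" for x v
  proof -
    have "((\<lambda>x. f x + g x) has_derivative
        (\<lambda>v. frechet_derivative f (at x) v + frechet_derivative g (at x) v)) (at x)"
      using Suc.prems that by (intro has_derivative_add) (simp_all add: frechet_derivative_works[symmetric])
    from frechet_derivative_at[OF this] show ?thesis by metis
  qed
  have "Ck_on k S (\<lambda>x. frechet_derivative (\<lambda>x. f x + g x) (at x) v)" for v
    by (rule iffD2[OF Ck_on_cong[OF assms(1) deriv] *])
  then show ?case
    using Suc.prems by (auto intro: differentiable_add)
qed

lemma Ck_on_mult:
  fixes f g :: "'a::real_normed_vector \<Rightarrow> 'b::real_normed_algebra"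
  assumes "open S" "Ck_on k S f" "Ck_on k S g"
  shows "Ck_on k S (\<lambda>x. f x * g x)"
  using assms(2,3)
proof (induction k arbitrary: f g)
  case 0
  then show ?case by (simp add: continuous_on_mult)
next
  case (Suc k)
  have *: "Ck_on k S (\<lambda>x. f x * frechet_derivative g (at x) v + frechet_derivative f (at x) v * g x)" for v
    using Suc.prems Ck_on_Suc_imp[OF Suc.prems(1)] Ck_on_Suc_imp[OF Suc.prems(2)]
    by (intro Ck_on_add[OF assms(1)] Suc.IH) auto
  have deriv: "frechet_derivative (\<lambda>x. f x * g x) (at x) v =
      f x * frechet_derivative g (at x) v + frechet_derivative f (at x) v * g x" if "x \<in> S" for x v
  proof -
    have "((\<lambda>x. f x * g x) has_derivative
        (\<lambda>v. f x * frechet_derivative g (at x) v + frechet_derivative f (at x) v * g x)) (at x)"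
      using Suc.prems that by (intro has_derivative_mult) (simp_all add: frechet_derivative_works[symmetric])
    from frechet_derivative_at[OF this] show ?thesis by metis
  qed
  have "Ck_on k S (\<lambda>x. frechet_derivative (\<lambda>x. f x * g x) (at x) v)" for v
    by (rule iffD2[OF Ck_on_cong[OF assms(1) deriv] *])
  then show ?case
    using Suc.prems by (auto intro: differentiable_mult)
qed

lemma smooth_funs_add:
  assumes "smooth_atlas A" "f \<in> smooth_funs A" "g \<in> smooth_funs A"
  shows "f + g \<in> smooth_funs A"
  unfolding smooth_funs_def smooth_on_def
proof clarify
  fix U \<phi> k assume c: "(U, \<phi>) \<in> A"
  have "open (\<phi> ` U)"
    using assms(1) c by (auto simp: smooth_atlas_def is_chart_def)
  moreover have "Ck_on k (\<phi> ` U) (f \<circ> inv_into U \<phi>)" "Ck_on k (\<phi> ` U) (g \<circ> inv_into U \<phi>)"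
    using assms(2,3) c by (auto simp: smooth_funs_def smooth_on_def)
  ultimately have "Ck_on k (\<phi> ` U) (\<lambda>x. (f \<circ> inv_into U \<phi>) x + (g \<circ> inv_into U \<phi>) x)"
    by (rule Ck_on_add)
  then show "Ck_on k (\<phi> ` U) ((f + g) \<circ> inv_into U \<phi>)"
    by (simp add: o_def)
qed

lemma smooth_funs_mult:
  assumes "smooth_atlas A" "f \<in> smooth_funs A" "g \<in> smooth_funs A"
  shows "f * g \<in> smooth_funs A"
  unfolding smooth_funs_def smooth_on_def
proof clarify
  fix U \<phi> k assume c: "(U, \<phi>) \<in> A"
  have "open (\<phi> ` U)"
    using assms(1) c by (auto simp: smooth_atlas_def is_chart_def)
  moreover have "Ck_on k (\<phi> ` U) (f \<circ> inv_into U \<phi>)" "Ck_on k (\<phi> ` U) (g \<circ> inv_into U \<phi>)"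
    using assms(2,3) c by (auto simp: smooth_funs_def smooth_on_def)
  ultimately have "Ck_on k (\<phi> ` U) (\<lambda>x. (f \<circ> inv_into U \<phi>) x * (g \<circ> inv_into U \<phi>) x)"
    by (rule Ck_on_mult)
  then show "Ck_on k (\<phi> ` U) ((f * g) \<circ> inv_into U \<phi>)"
    by (simp add: o_def)
qed

lemma smooth_funs_const: "(\<lambda>_. c) \<in> smooth_funs A"
  by (auto simp: smooth_funs_def smooth_on_def o_def Ck_on_const)

lemma smooth_funs_uminus:
  assumes "smooth_atlas A" "f \<in> smooth_funs A"
  shows "- f \<in> smooth_funs A"
  using smooth_funs_mult[OF assms(1) smooth_funs_const[of "-1"] assms(2)]
  by (simp add: times_fun_def fun_Compl_def)

section \<open>The Lie algebra of vector fields\<close>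

lemma tangent_space_add: "v \<in> tangent_space A p \<Longrightarrow> w \<in> tangent_space A p \<Longrightarrow> v + w \<in> tangent_space A p"
  by (simp add: tangent_space_def algebra_simps)

lemma tangent_space_uminus: "v \<in> tangent_space A p \<Longrightarrow> - v \<in> tangent_space A p"
  by (simp add: tangent_space_def algebra_simps)

lemma tangent_space_0: "0 \<in> tangent_space A p"
  by (simp add: tangent_space_def)

lemma tangent_add:
  assumes "v \<in> tangent_space A p" "f \<in> smooth_funs A" "g \<in> smooth_funs A"
  shows "v (\<lambda>q. f q + g q) = v f + v g"
  using assms by (auto simp: tangent_space_def plus_fun_def)

lemma tangent_mult:
  assumes "v \<in> tangent_space A p" "f \<in> smooth_funs A" "g \<in> smooth_funs A"
  shows "v (\<lambda>q. f q * g q) = f p * v g + g p * v f"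
  using assms by (auto simp: tangent_space_def times_fun_def)

lemma tangent_scale:
  assumes "v \<in> tangent_space A p" "f \<in> smooth_funs A"
  shows "v (\<lambda>q. c * f q) = c * v f"
  using assms by (auto simp: tangent_space_def)

lemma tangent_0:
  assumes "v \<in> tangent_space A p"
  shows "v (\<lambda>q. 0) = 0"
  using tangent_scale[OF assms smooth_funs_const, of 0] by simp

lemma tangent_nonsmooth: "v \<in> tangent_space A p \<Longrightarrow> f \<notin> smooth_funs A \<Longrightarrow> v f = 0"
  by (simp add: tangent_space_def)

lemma vector_fields_at: "X \<in> vector_fields A \<Longrightarrow> X p \<in> tangent_space A p"
  by (simp add: vector_fields_def)

lemma vector_fields_smooth:
  "X \<in> vector_fields A \<Longrightarrow> f \<in> smooth_funs A \<Longrightarrow> (\<lambda>p. X p f) \<in> smooth_funs A"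
  by (simp add: vector_fields_def)

lemma vector_fields_0: "0 \<in> vector_fields A"
  by (simp add: vector_fields_def tangent_space_0 smooth_funs_const)

lemma vector_fields_add:
  assumes "smooth_atlas A" "X \<in> vector_fields A" "Y \<in> vector_fields A"
  shows "X + Y \<in> vector_fields A"
  using assms smooth_funs_add[OF assms(1), unfolded plus_fun_def]
  by (simp add: vector_fields_def tangent_space_add)

lemma vector_fields_uminus:
  assumes "smooth_atlas A" "X \<in> vector_fields A"
  shows "- X \<in> vector_fields A"
  using assms smooth_funs_uminus[OF assms(1), unfolded fun_Compl_def]
  by (simp add: vector_fields_def tangent_space_uminus)

lemma lie_add_left:
  assumes "X \<in> vector_fields A" "Y \<in> vector_fields A" "Z \<in> vector_fields A"
  shows "lie (X + Y) Z = lie X Z + lie Y Z"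
proof (intro ext)
  fix p f
  show "lie (X + Y) Z p f = (lie X Z + lie Y Z) p f"
  proof (cases "f \<in> smooth_funs A")
    case True
    have "Z p (\<lambda>q. X q f + Y q f) = Z p (\<lambda>q. X q f) + Z p (\<lambda>q. Y q f)"
      using True assms by (intro tangent_add) (auto intro: vector_fields_at vector_fields_smooth)
    then show ?thesis by (simp add: lie_def)
  next
    \<comment> \<open>For non-smooth \<open>f\<close> the inner functions are identically 0, and
      derivations vanish on the zero function.\<close>
    case False
    then show ?thesis
      using assms by (simp add: lie_def tangent_nonsmooth[OF vector_fields_at] tangent_0[OF vector_fields_at])
  qed
qed

lemma lie_swap: "lie X Y = - lie Y X"
  by (simp add: lie_def fun_eq_iff)

lemma lie_add_right:
  assumes "X \<in> vector_fields A" "Y \<in> vector_fields A" "Z \<in> vector_fields A"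
  shows "lie X (Y + Z) = lie X Y + lie X Z"
  using lie_add_left[OF assms(2,3,1)] by (simp add: lie_swap[of X])

text \<open>The mixed terms \<open>X f * Y g + Y f * X g\<close>, which keep the composite of
  \<open>X\<close> and \<open>Y\<close> from being a derivation, are symmetric in \<open>X\<close>
  and \<open>Y\<close> and cancel in the commutator.\<close>

lemma lie_vector_fields:
  assumes A: "smooth_atlas A" and X: "X \<in> vector_fields A" and Y: "Y \<in> vector_fields A"
  shows "lie X Y \<in> vector_fields A"
proof -
  note XY = vector_fields_at[OF X] vector_fields_at[OF Y]
  note [simp] = vector_fields_smooth[OF X] vector_fields_smooth[OF Y]
  have mult [simp]: "(\<lambda>q. f q * g q) \<in> smooth_funs A"
    if "f \<in> smooth_funs A" "g \<in> smooth_funs A" for f g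
    using smooth_funs_mult[OF A that] by (simp add: times_fun_def)
  note simps = lie_def plus_fun_def times_fun_def
    XY[THEN tangent_add] XY[THEN tangent_mult] XY[THEN tangent_scale]
  have "lie X Y p \<in> tangent_space A p" for p
    unfolding tangent_space_def
  proof (intro CollectI conjI ballI allI impI)
    fix f g assume [simp]: "f \<in> smooth_funs A" "g \<in> smooth_funs A"
    show "lie X Y p (f + g) = lie X Y p f + lie X Y p g"
      by (simp add: simps)
    show "lie X Y p (f * g) = f p * lie X Y p g + g p * lie X Y p f"
      by (simp add: simps algebra_simps)
  next
    fix c f assume [simp]: "f \<in> smooth_funs A"
    show "lie X Y p (\<lambda>q. c * f q) = c * lie X Y p f"
      by (simp add: simps algebra_simps)
  next
    fix f assume "f \<notin> smooth_funs A"
    then show "lie X Y p f = 0"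
      by (simp add: lie_def XY[THEN tangent_nonsmooth] XY[THEN tangent_0])
  qed
  moreover have "(\<lambda>p. lie X Y p f) \<in> smooth_funs A" if f: "f \<in> smooth_funs A" for f
    using smooth_funs_add[OF A _ smooth_funs_uminus[OF A], of "\<lambda>p. X p (\<lambda>q. Y q f)" "\<lambda>p. Y p (\<lambda>q. X q f)"] f
    by (simp add: lie_def plus_fun_def fun_Compl_def)
  ultimately show ?thesis by (simp add: vector_fields_def)
qed

section \<open>Pairs of anticommuting involutions on an additive group with a bracket\<close>

text \<open>The eigenspace arguments need no scalars: every division by 2 becomes a doubling that
  \<open>double_zero\<close> cancels. The carrier \<open>V\<close> is explicit because the type also
  contains fields that are neither tangent nor smooth.\<close>

locale biparacomplex_module =
  fixes V :: "'v::ab_group_add set"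
    and L :: "'v \<Rightarrow> 'v \<Rightarrow> 'v"
    and F P :: "'v \<Rightarrow> 'v"
  assumes double_zero: "\<And>x::'v. x + x = 0 \<Longrightarrow> x = 0"
    and zero_V: "0 \<in> V"
    and add_V: "x \<in> V \<Longrightarrow> y \<in> V \<Longrightarrow> x + y \<in> V"
    and uminus_V: "x \<in> V \<Longrightarrow> - x \<in> V"
    and L_V: "x \<in> V \<Longrightarrow> y \<in> V \<Longrightarrow> L x y \<in> V"
    and F_V: "x \<in> V \<Longrightarrow> F x \<in> V"
    and P_V: "x \<in> V \<Longrightarrow> P x \<in> V"
    and L_add_left: "x \<in> V \<Longrightarrow> y \<in> V \<Longrightarrow> z \<in> V \<Longrightarrow> L (x + y) z = L x z + L y z"
    and L_add_right: "x \<in> V \<Longrightarrow> y \<in> V \<Longrightarrow> z \<in> V \<Longrightarrow> L x (y + z) = L x y + L x z"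
    and F_add: "x \<in> V \<Longrightarrow> y \<in> V \<Longrightarrow> F (x + y) = F x + F y"
    and P_add: "x \<in> V \<Longrightarrow> y \<in> V \<Longrightarrow> P (x + y) = P x + P y"
    and FF: "x \<in> V \<Longrightarrow> F (F x) = x"
    and PP: "x \<in> V \<Longrightarrow> P (P x) = x"
    and FP: "x \<in> V \<Longrightarrow> F (P x) = - P (F x)"
begin

lemma diff_V: "x \<in> V \<Longrightarrow> y \<in> V \<Longrightarrow> x - y \<in> V"
  using add_V[of x "- y"] uminus_V by simp

text \<open>Kept generic in \<open>h\<close> so that it serves \<open>F\<close>, \<open>P\<close>,
  each slot of \<open>L\<close> and later each slot of a connection.\<close>

lemma uminus_of_additive:
  assumes "\<And>x y. x \<in> V \<Longrightarrow> y \<in> V \<Longrightarrow> h (x + y) = h x + (h y :: 'v)" "x \<in> V"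
  shows "h (- x) = - h x"
proof -
  have "h 0 = 0" using assms(1)[OF zero_V zero_V] by simp
  moreover have "h (x + - x) = h x + h (- x)" using assms uminus_V by blast
  ultimately show ?thesis by (simp add: eq_neg_iff_add_eq_0 add.commute)
qed

lemma diff_of_additive:
  assumes "\<And>x y. x \<in> V \<Longrightarrow> y \<in> V \<Longrightarrow> h (x + y) = h x + (h y :: 'v)" "x \<in> V" "y \<in> V"
  shows "h (x - y) = h x - h y"
  using assms(1)[of x "- y"] uminus_of_additive[OF assms(1), of y] assms(2,3) uminus_V by simp

lemma F_uminus: "x \<in> V \<Longrightarrow> F (- x) = - F x"
  by (rule uminus_of_additive[of F]) (use F_add in auto)

lemma P_uminus: "x \<in> V \<Longrightarrow> P (- x) = - P x"
  by (rule uminus_of_additive[of P]) (use P_add in auto)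

lemma F_diff: "x \<in> V \<Longrightarrow> y \<in> V \<Longrightarrow> F (x - y) = F x - F y"
  by (rule diff_of_additive[of F]) (use F_add in auto)

lemma P_diff: "x \<in> V \<Longrightarrow> y \<in> V \<Longrightarrow> P (x - y) = P x - P y"
  by (rule diff_of_additive[of P]) (use P_add in auto)

lemma L_uminus_left: "x \<in> V \<Longrightarrow> y \<in> V \<Longrightarrow> L (- x) y = - L x y"
  by (rule uminus_of_additive[of "\<lambda>x. L x y"]) (use L_add_left in auto)

lemma L_uminus_right: "x \<in> V \<Longrightarrow> y \<in> V \<Longrightarrow> L x (- y) = - L x y"
  by (rule uminus_of_additive[of "L x"]) (use L_add_right in auto)

lemmas closed = zero_V add_V uminus_V diff_V L_V F_V P_V

lemmas linear = F_add P_add F_uminus P_uminus F_diff P_diff L_add_left L_add_right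
  L_uminus_left L_uminus_right

text \<open>The axioms are symmetric in the two involutions, so results on the eigenspaces of
  \<open>F\<close> can be reused for those of \<open>P\<close>.\<close>

lemma swap: "biparacomplex_module V L P F"
proof unfold_locales
  show "P (F x) = - F (P x)" if "x \<in> V" for x
    using FP[OF that] by simp
qed (fact double_zero | simp add: closed linear FF PP)+

definition N :: "'v \<Rightarrow> 'v \<Rightarrow> 'v" where
  "N x y = L (F x) (P y) + L (P x) (F y) + P (F (L x y)) + F (P (L x y))
     - F (L (P x) y) - F (L x (P y)) - P (L (F x) y) - P (L x (F y))"

lemma N_zero_imp_closed_plus:
  assumes N: "N x y = 0" and V: "x \<in> V" "y \<in> V" and F: "F x = x" "F y = y"
  shows "F (L x y) = L x y"
proof -
  define Z where "Z = L x (P y) + L (P x) y"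
  define W where "W = P (L x y)"
  have ZW: "Z \<in> V" "W \<in> V" using V by (auto simp: Z_def W_def closed)
  \<comment> \<open>The first two brackets give \<open>Z\<close>, the terms under \<open>F\<close>
    give \<open>- F Z\<close>, those under \<open>P\<close> give \<open>- W\<close> twice, and the
    middle terms cancel by anticommutation.\<close>
  have "N x y = Z - F Z - (W + W)"
    using V F by (simp add: N_def Z_def W_def closed linear FP algebra_simps)
  then have 1: "Z - F Z = W + W"
    using N by simp
  \<comment> \<open>\<open>F\<close> reverses the sign of \<open>Z - F Z\<close>, so the doubles of
    \<open>F W\<close> and \<open>W\<close> are opposite.\<close>
  then have "F (Z - F Z) = F (W + W)"
    by (rule arg_cong)
  then have 2: "F Z - Z = F W + F W"
    using ZW by (simp only: F_add F_diff FF F_V)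
  have "(F W + W) + (F W + W) = (F W + F W) + (W + W)"
    by (simp add: ac_simps)
  also have "\<dots> = (F Z - Z) + (Z - F Z)"
    by (simp only: 1 2)
  finally have "(F W + W) + (F W + W) = 0"
    by simp
  then have "F W = - W"
    using double_zero eq_neg_iff_add_eq_0 by blast
  then have "P (F (L x y)) = P (L x y)"
    using V by (simp add: W_def FP closed)
  then show ?thesis using V by (metis PP F_V L_V)
qed

text \<open>The minus eigenspace of \<open>F\<close> is the plus eigenspace of \<open>- F\<close>.
  The pair of \<open>- F\<close> and \<open>P\<close> satisfies the same axioms, and
  \<open>N\<close>, being linear in \<open>F\<close>, only changes sign.\<close>

lemma N_zero_imp_closed_minus:
  assumes N: "N x y = 0" and V: "x \<in> V" "y \<in> V" and F: "F x = - x" "F y = - y"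
  shows "F (L x y) = - L x y"
proof -
  interpret opp: biparacomplex_module V L "\<lambda>x. - F x" P
    by unfold_locales (fact double_zero | simp add: closed linear FF PP FP)+
  have "opp.N x y = - N x y"
    using V by (simp add: opp.N_def N_def closed linear)
  then have "- F (L x y) = L x y"
    using opp.N_zero_imp_closed_plus[of x y] N V F by simp
  then show ?thesis
    by (simp add: minus_equation_iff[of _ "L x y"])
qed

end

section \<open>Connections commuting with both involutions, and their torsion\<close>

locale biparacomplex_connection = biparacomplex_module +
  fixes D :: "'a \<Rightarrow> 'a \<Rightarrow> 'a"
  assumes D_V: "x \<in> V \<Longrightarrow> y \<in> V \<Longrightarrow> D x y \<in> V"
    and D_add_left: "x \<in> V \<Longrightarrow> y \<in> V \<Longrightarrow> z \<in> V \<Longrightarrow> D (x + y) z = D x z + D y z"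
    and D_add_right: "x \<in> V \<Longrightarrow> y \<in> V \<Longrightarrow> z \<in> V \<Longrightarrow> D x (y + z) = D x y + D x z"
    and D_F: "x \<in> V \<Longrightarrow> y \<in> V \<Longrightarrow> D x (F y) = F (D x y)"
    and D_P: "x \<in> V \<Longrightarrow> y \<in> V \<Longrightarrow> D x (P y) = P (D x y)"
    and D_mixed: "x \<in> V \<Longrightarrow> y \<in> V \<Longrightarrow> F x = x \<Longrightarrow> F y = - y \<Longrightarrow> D x y - D y x - L x y = 0"
begin

definition T :: "'a \<Rightarrow> 'a \<Rightarrow> 'a" where
  "T x y = D x y - D y x - L x y"

lemma D_uminus_left: "x \<in> V \<Longrightarrow> y \<in> V \<Longrightarrow> D (- x) y = - D x y"
  by (rule uminus_of_additive[of "\<lambda>x. D x y"]) (use D_add_left in auto)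

lemma D_uminus_right: "x \<in> V \<Longrightarrow> y \<in> V \<Longrightarrow> D x (- y) = - D x y"
  by (rule uminus_of_additive[of "D x"]) (use D_add_right in auto)

lemmas D_linear = D_add_left D_add_right D_uminus_left D_uminus_right D_F D_P

lemma T_V: "x \<in> V \<Longrightarrow> y \<in> V \<Longrightarrow> T x y \<in> V"
  by (simp add: T_def closed D_V)

lemma T_add_left: "x \<in> V \<Longrightarrow> y \<in> V \<Longrightarrow> z \<in> V \<Longrightarrow> T (x + y) z = T x z + T y z"
  by (simp add: T_def linear D_linear)

lemma T_add_right: "x \<in> V \<Longrightarrow> y \<in> V \<Longrightarrow> z \<in> V \<Longrightarrow> T x (y + z) = T x y + T x z"
  by (simp add: T_def linear D_linear)

lemma T_uminus_left: "x \<in> V \<Longrightarrow> y \<in> V \<Longrightarrow> T (- x) y = - T x y"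
  by (simp add: T_def linear D_linear)

lemma T_uminus_right: "x \<in> V \<Longrightarrow> y \<in> V \<Longrightarrow> T x (- y) = - T x y"
  by (simp add: T_def linear D_linear)

lemmas T_linear = T_add_left T_add_right T_uminus_left T_uminus_right

lemma T_mixed:
  assumes "x \<in> V" "y \<in> V" "F x = x" "F y = - y"
  shows "T x y = 0"
  using D_mixed[OF assms] by (simp add: T_def)

text \<open>After \<open>L\<close> is replaced by the commutator of \<open>D\<close>, terms with
  \<open>F\<close> or \<open>P\<close> in the direction slot cancel in pairs; all others carry
  \<open>F P + P F\<close>, which is 0.\<close>

lemma T_zero_imp_N_zero:
  assumes T: "\<And>x y. x \<in> V \<Longrightarrow> y \<in> V \<Longrightarrow> T x y = 0" and V: "x \<in> V" "y \<in> V"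
  shows "N x y = 0"
proof -
  have L: "L x y = D x y - D y x" if "x \<in> V" "y \<in> V" for x y
    using T[OF that] by (simp add: T_def)
  show ?thesis
    using V by (simp add: N_def L closed linear D_linear D_V FP)
qed

text \<open>\<open>D x\<close> commutes with \<open>F\<close> and so preserves its eigenspaces; the
  torsion stays in one as soon as the bracket does. The parameter \<open>s\<close> treats both signs
  at once.\<close>

lemma T_F_sign:
  assumes s: "s = id \<or> s = uminus" and V: "x \<in> V" "y \<in> V"
    and "F x = s x" "F y = s y" "F (L x y) = s (L x y)"
  shows "F (T x y) = s (T x y)"
proof -
  have "F (D x y) = s (D x y)" "F (D y x) = s (D y x)"
    using assms D_F[of x y] D_F[of y x] by (auto simp: D_uminus_right)
  then show ?thesis
    using assms by (auto simp: T_def closed linear D_V)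
qed

lemma T_P_sign:
  assumes s: "s = id \<or> s = uminus" and V: "x \<in> V" "y \<in> V"
    and "P x = s x" "P y = s y" "P (L x y) = s (L x y)"
  shows "P (T x y) = s (T x y)"
proof -
  have "P (D x y) = s (D x y)" "P (D y x) = s (D y x)"
    using assms D_P[of x y] D_P[of y x] by (auto simp: D_uminus_right)
  then show ?thesis
    using assms by (auto simp: T_def closed linear D_V)
qed

text \<open>\<open>T_mixed\<close> covers only the order plus, minus; this supplies the other
  order.\<close>

lemma T_swap_zero:
  assumes "L x y = - L y x" "T x y = 0"
  shows "T y x = 0"
  using assms by (simp add: T_def algebra_simps)

lemma involutive_imp_T_zero:
  assumes L_swap: "\<And>x y. x \<in> V \<Longrightarrow> y \<in> V \<Longrightarrow> L x y = - L y x"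
    and Fp: "\<And>x y. x \<in> V \<Longrightarrow> y \<in> V \<Longrightarrow> F x = x \<Longrightarrow> F y = y \<Longrightarrow> F (L x y) = L x y"
    and Fm: "\<And>x y. x \<in> V \<Longrightarrow> y \<in> V \<Longrightarrow> F x = - x \<Longrightarrow> F y = - y \<Longrightarrow> F (L x y) = - L x y"
    and Pp: "\<And>x y. x \<in> V \<Longrightarrow> y \<in> V \<Longrightarrow> P x = x \<Longrightarrow> P y = y \<Longrightarrow> P (L x y) = L x y"
    and Pm: "\<And>x y. x \<in> V \<Longrightarrow> y \<in> V \<Longrightarrow> P x = - x \<Longrightarrow> P y = - y \<Longrightarrow> P (L x y) = - L x y"
    and V: "x \<in> V" "y \<in> V"
  shows "T x y = 0"
proof -
  have self_neg: "z = 0" if "z = - z" for z :: 'a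
    using that double_zero eq_neg_iff_add_eq_0 by blast
  have mixed: "T x y = 0" "T y x = 0" if "x \<in> V" "y \<in> V" "F x = x" "F y = - y" for x y
    using T_mixed[OF that] T_swap_zero[OF L_swap] that by auto
  have plus: "T x y = 0 \<and> T (P x) (P y) = 0" if xy: "x \<in> V" "y \<in> V" "F x = x" "F y = y" for x y
  proof -
    have FPxy: "F (P x) = - P x" "F (P y) = - P y" using xy by (auto simp: FP)
    \<comment> \<open>The cross terms pair opposite eigenspaces of \<open>F\<close>, because
      \<open>P\<close> exchanges them, and so vanish by \<open>mixed\<close>.\<close>
    have "T (x + P x) (y + P y) = T x y + T (P x) (P y)"
      using xy FPxy by (simp add: T_linear closed mixed)
    \<comment> \<open>The form \<open>x + - P x\<close> is kept so that the sum and negation rules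
      in \<open>T_linear\<close> apply.\<close>
    moreover have "T (x + - P x) (y + - P y) = T x y + T (P x) (P y)"
      using xy FPxy by (simp only: T_linear closed mixed) simp
    moreover have "P (T (x + P x) (y + P y)) = T (x + P x) (y + P y)"
      using T_P_sign[of id "x + P x" "y + P y"] Pp[of "x + P x" "y + P y"] xy
      by (simp add: closed P_add PP add.commute)
    moreover have "P (T (x + - P x) (y + - P y)) = - T (x + - P x) (y + - P y)"
      using T_P_sign[of uminus "x + - P x" "y + - P y"] Pm[of "x + - P x" "y + - P y"] xy
      by (simp add: closed P_diff PP)
    ultimately have "T x y + T (P x) (P y) = 0"
      using self_neg by metis
    then have eq: "T (P x) (P y) = - T x y"
      by (simp add: eq_neg_iff_add_eq_0 add.commute)
    have "F (T x y) = T x y"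
      using T_F_sign[of id x y] Fp xy by simp
    moreover have "F (T (P x) (P y)) = - T (P x) (P y)"
      using T_F_sign[of uminus "P x" "P y"] Fm FPxy xy by (simp add: closed)
    ultimately have "T x y = 0"
      using eq self_neg xy by (simp add: F_uminus T_V)
    with eq show ?thesis by simp
  qed
  \<comment> \<open>Here \<open>P x\<close> and \<open>P y\<close> are fixed by \<open>F\<close>,
    and the second half of \<open>plus\<close> returns to \<open>x\<close> and \<open>y\<close>
    since \<open>P\<close> is an involution.\<close>
  have minus: "T x y = 0" if "x \<in> V" "y \<in> V" "F x = - x" "F y = - y" for x y
    using plus[of "P x" "P y"] that by (simp add: closed FP P_uminus PP)
  \<comment> \<open>This splits \<open>x + x\<close> and \<open>y + y\<close> into eigenvectors of
    \<open>F\<close> without halving; the resulting fourfold torsion is cancelled by using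
    \<open>double_zero\<close> twice.\<close>
  have "T ((x + F x) + (x + - F x)) ((y + F y) + (y + - F y)) = 0"
    (is "T (?xp + ?xm) (?yp + ?ym) = 0")
  proof -
    have *: "?xp \<in> V" "?xm \<in> V" "?yp \<in> V" "?ym \<in> V" "F ?xp = ?xp" "F ?yp = ?yp"
      "F ?xm = - ?xm" "F ?ym = - ?ym"
      using V by (simp_all only: closed linear FF) (simp_all add: add.commute)
    have "T ?xp ?yp = 0" "T ?xp ?ym = 0" "T ?xm ?yp = 0" "T ?xm ?ym = 0"
      using plus[OF *(1,3,5,6)] mixed(1)[OF *(1,4,5,8)] mixed(2)[OF *(3,2,6,7)] minus[OF *(2,4,7,8)]
      by blast+
    then show ?thesis
      using * by (simp only: T_linear add_V) simp
  qed
  moreover have "(z + F z) + (z + - F z) = z + z" for z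
    by simp
  ultimately have "T (x + x) (y + y) = 0"
    by simp
  then have "(T x y + T x y) + (T x y + T x y) = 0"
    using V by (simp add: T_linear closed)
  then show ?thesis
    using double_zero by blast
qed

end

section \<open>Transfer to vector fields on the manifold\<close>

theorem theorem6:
  fixes A :: "('m::{t2_space, second_countable_topology}, 'e::euclidean_space) chart set"
    and F P :: "'m endo_field"
    and nabla :: "'m conn"
  assumes "smooth_atlas A"
    and "almost_biparacomplex A F P"
    and "canonical_connection A F P nabla"
  shows "(biparacomplex A F P \<longleftrightarrow>
            (\<forall>X\<in>vector_fields A. \<forall>Y\<in>vector_fields A. nijenhuis_bracket F P X Y = 0)) \<and>
         (biparacomplex A F P \<longleftrightarrow>
            (\<forall>X\<in>vector_fields A. \<forall>Y\<in>vector_fields A. torsion nabla X Y = 0))"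
proof -
  let ?V = "vector_fields A"
  note ab = assms(2)[unfolded almost_biparacomplex_def]
  note cc = assms(3)[unfolded canonical_connection_def]
  have tensor: "Q \<cdot> X \<in> ?V" "Q \<cdot> (X + Y) = Q \<cdot> X + Q \<cdot> Y"
    if "Q \<in> tensor_fields_11 A" "X \<in> ?V" "Y \<in> ?V" for Q X Y
    using that by (simp_all add: tensor_fields_11_def endo_app_def vector_fields_at fun_eq_iff)
  have plus: "X \<in> sections A (dist_plus A Q) \<longleftrightarrow> X \<in> ?V \<and> Q \<cdot> X = X" for Q X
    by (auto simp: sections_def dist_plus_def endo_app_def fun_eq_iff[of _ X] vector_fields_at)
  have minus: "X \<in> sections A (dist_minus A Q) \<longleftrightarrow> X \<in> ?V \<and> Q \<cdot> X = - X" for Q X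
    by (auto simp: sections_def dist_minus_def endo_app_def fun_eq_iff[of _ "- X"] vector_fields_at
        eq_neg_iff_add_eq_0[of "Q p v" v for p v])
  interpret biparacomplex_connection ?V lie "\<lambda>X. F \<cdot> X" "\<lambda>X. P \<cdot> X" nabla
  proof unfold_locales
    fix X :: "'m vfield" assume "X + X = 0"
    then show "X = 0" by (simp add: fun_eq_iff)
  next
    fix X assume X: "X \<in> ?V"
    show "F \<cdot> X \<in> ?V" "P \<cdot> X \<in> ?V" using ab X tensor(1) by blast+
    \<comment> \<open>Extensionality is applied over points only, so the goals stay equations
      between tangent vectors, as in \<open>almost_biparacomplex\<close>.\<close>
    show "F \<cdot> F \<cdot> X = X" "P \<cdot> P \<cdot> X = X" "F \<cdot> P \<cdot> X = - (P \<cdot> F \<cdot> X)"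
      using ab vector_fields_at[OF X]
      by (auto simp: endo_app_def fun_Compl_def[of "\<lambda>p. P p (F p (X p))"] eq_neg_iff_add_eq_0
          intro!: ext[where 'a='m])
  next
    fix X Y assume XY: "X \<in> ?V" "Y \<in> ?V"
    show "F \<cdot> (X + Y) = F \<cdot> X + F \<cdot> Y" "P \<cdot> (X + Y) = P \<cdot> X + P \<cdot> Y"
      using ab XY tensor(2) by blast+
    show "nabla X Y \<in> ?V"
      using cc XY by (simp add: linear_connection_def)
    show "nabla X (F \<cdot> Y) = F \<cdot> nabla X Y" "nabla X (P \<cdot> Y) = P \<cdot> nabla X Y"
      using cc XY by (simp_all add: parallel_def)
    show "nabla X Y - nabla Y X - lie X Y = 0" if "F \<cdot> X = X" "F \<cdot> Y = - Y"
      using cc XY that by (simp add: plus minus torsion_def)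
  next
    fix X Y Z assume "X \<in> ?V" "Y \<in> ?V" "Z \<in> ?V"
    then show "nabla (X + Y) Z = nabla X Z + nabla Y Z" "nabla X (Y + Z) = nabla X Y + nabla X Z"
      using cc by (simp_all add: linear_connection_def)
  qed (simp_all add: assms(1) vector_fields_0 vector_fields_add vector_fields_uminus
      lie_vector_fields lie_add_left[of _ A] lie_add_right[of _ A])
  interpret PF: biparacomplex_module ?V lie "\<lambda>X. P \<cdot> X" "\<lambda>X. F \<cdot> X"
    by (rule swap)
  have N_eq: "nijenhuis_bracket F P X Y = N X Y" for X Y
    by (simp add: nijenhuis_bracket_def N_def)
  \<comment> \<open>The bracket is symmetric in \<open>F\<close> and \<open>P\<close>, so one
    vanishing hypothesis controls the eigenspaces of both.\<close>
  have PF_N: "PF.N X Y = N X Y" for X Y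
    by (simp add: PF.N_def N_def algebra_simps)
  have T_eq: "torsion nabla X Y = T X Y" for X Y
    by (simp add: torsion_def T_def)
  have bi: "biparacomplex A F P \<longleftrightarrow> (\<forall>X\<in>?V. \<forall>Y\<in>?V.
      (F \<cdot> X = X \<longrightarrow> F \<cdot> Y = Y \<longrightarrow> F \<cdot> lie X Y = lie X Y) \<and>
      (F \<cdot> X = - X \<longrightarrow> F \<cdot> Y = - Y \<longrightarrow> F \<cdot> lie X Y = - lie X Y) \<and>
      (P \<cdot> X = X \<longrightarrow> P \<cdot> Y = Y \<longrightarrow> P \<cdot> lie X Y = lie X Y) \<and>
      (P \<cdot> X = - X \<longrightarrow> P \<cdot> Y = - Y \<longrightarrow> P \<cdot> lie X Y = - lie X Y))"
    using assms(2) by (auto simp: biparacomplex_def involutive_def plus minus L_V)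
  \<comment> \<open>The equivalences are closed as a cycle: involutivity gives zero torsion, this
    gives a zero bracket, and that gives involutivity.\<close>
  have "\<forall>X\<in>?V. \<forall>Y\<in>?V. T X Y = 0" if "biparacomplex A F P"
    using that unfolding bi by (intro ballI involutive_imp_T_zero lie_swap) blast+
  moreover have "\<forall>X\<in>?V. \<forall>Y\<in>?V. N X Y = 0" if "\<forall>X\<in>?V. \<forall>Y\<in>?V. T X Y = 0"
    using that T_zero_imp_N_zero by blast
  moreover have "biparacomplex A F P" if "\<forall>X\<in>?V. \<forall>Y\<in>?V. N X Y = 0"
    unfolding bi using that N_zero_imp_closed_plus N_zero_imp_closed_minus
      PF.N_zero_imp_closed_plus PF.N_zero_imp_closed_minus by (simp add: PF_N)
  ultimately show ?thesis
    unfolding N_eq T_eq by blast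
qed

end
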